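(* Let $m\ge 3$ and $n\ge 3$ be integers and let $T_{m,n}=C_m\,\square\,C_n$ be the torus graph. Then $$\mu(T_{m,n})\le 3\cdot\min(m,n).$$
   Context: $C_k$ denotes the cycle graph with $k$ vertices. The Cartesian product $G_1\,\square\,G_2$ of $G_1=(V_1,E_1)$ and $G_2=(V_2,E_2)$ has vertex set $V_1\times V_2$, with $(u_1,u_2)$ adjacent to $(v_1,v_2)$ iff either $u_1=v_1$ and $u_2v_2\in E_2$, or $u_2=v_2$ and $u_1v_1\in E_1$. For a graph $G=(V,E)$ and $P\subseteq V$, two vertices $u,v\in P$ are mutually visible if there is a shortest $(u,v)$-path in $G$ containing no vertex of $P$ other than $u$ and $v$. $P$ is a mutual-visibility set of $G$ if its vertices are pairwise mutually visible. The mutual-visibility number $\mu(G)$ is the maximum cardinality of a mutual-visibility set of $G$. *)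

theory Defs
  imports "Graph_Theory.Graph_Theory"
begin

text \<open>
  Simple graphs are represented as in the library, by the locale \<^locale>\<open>pair_graph\<close>:
  finite, loop-free symmetric digraphs, an undirected edge \<open>uv\<close> being the two arcs
  \<open>(u,v)\<close> and \<open>(v,u)\<close>.
\<close>

text \<open>Only \<open>k \<ge> 3\<close> is meaningful; \<open>cycle_graph 1\<close> has a loop.\<close>

definition cycle_graph :: "nat \<Rightarrow> nat pair_pre_digraph" where
  "cycle_graph k = \<lparr> pverts = {..<k},
     parcs = {(u, v). u < k \<and> v < k \<and> (v = (u + 1) mod k \<or> u = (v + 1) mod k)} \<rparr>"

definition cartesian_product ::
  "'a pair_pre_digraph \<Rightarrow> 'b pair_pre_digraph \<Rightarrow> ('a \<times> 'b) pair_pre_digraph" (infixr \<open>\<box>\<close> 75) where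
  "G \<box> H = \<lparr> pverts = pverts G \<times> pverts H,
     parcs = {((u\<^sub>1, u\<^sub>2), (v\<^sub>1, v\<^sub>2)).
       (u\<^sub>1 = v\<^sub>1 \<and> u\<^sub>1 \<in> pverts G \<and> (u\<^sub>2, v\<^sub>2) \<in> parcs H) \<or>
       (u\<^sub>2 = v\<^sub>2 \<and> u\<^sub>2 \<in> pverts H \<and> (u\<^sub>1, v\<^sub>1) \<in> parcs G)} \<rparr>"

definition torus_graph :: "nat \<Rightarrow> nat \<Rightarrow> (nat \<times> nat) pair_pre_digraph" where
  "torus_graph m n = cycle_graph m \<box> cycle_graph n"

lemma pair_graph_cycle_graph:
  assumes "k \<ge> 3"
  shows "pair_graph (cycle_graph k)"
proof
  fix e assume "e \<in> parcs (cycle_graph k)"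
  then show "fst e \<in> pverts (cycle_graph k)" "snd e \<in> pverts (cycle_graph k)"
    by (auto simp: cycle_graph_def)
next
  show "finite (pverts (cycle_graph k))" by (simp add: cycle_graph_def)
  show "finite (parcs (cycle_graph k))"
    by (rule finite_subset[of _ "{..<k} \<times> {..<k}"]) (auto simp: cycle_graph_def)
next
  fix e assume "e \<in> parcs (cycle_graph k)"
  then show "fst e \<noteq> snd e"
    using assms by (auto simp: cycle_graph_def mod_Suc split: if_splits)
next
  show "symmetric (with_proj (cycle_graph k))"
    by (auto simp: symmetric_def cycle_graph_def intro!: symI)
qed

lemma pair_graph_cartesian_product:
  assumes "pair_graph G" "pair_graph H"
  shows "pair_graph (G \<box> H)"
proof -
  interpret G: pair_graph G by fact
  interpret H: pair_graph H by fact
  have sG: "(v, u) \<in> parcs G" if "(u, v) \<in> parcs G" for u v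
    using G.pair_sym_arcs that unfolding symmetric_def with_proj_simps by (rule symD)
  have sH: "(v, u) \<in> parcs H" if "(u, v) \<in> parcs H" for u v
    using H.pair_sym_arcs that unfolding symmetric_def with_proj_simps by (rule symD)
  have nG: "(u, u) \<notin> parcs G" for u
    using G.pair_no_loops[of "(u, u)"] by auto
  have nH: "(u, u) \<notin> parcs H" for u
    using H.pair_no_loops[of "(u, u)"] by auto
  have sub: "parcs (G \<box> H) \<subseteq> pverts (G \<box> H) \<times> pverts (G \<box> H)"
    by (auto simp: cartesian_product_def dest: G.wellformed' H.wellformed')
  have fin: "finite (pverts (G \<box> H))"
    by (simp add: cartesian_product_def G.pair_finite_verts H.pair_finite_verts)
  show ?thesis
  proof
    fix e assume e: "e \<in> parcs (G \<box> H)"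
    then show "fst e \<in> pverts (G \<box> H)" "snd e \<in> pverts (G \<box> H)"
      using sub by auto
    show "fst e \<noteq> snd e"
      using e nG nH by (auto simp: cartesian_product_def)
  next
    show "finite (pverts (G \<box> H))" by fact
    show "finite (parcs (G \<box> H))"
      using finite_subset[OF sub] fin by simp
  next
    show "symmetric (with_proj (G \<box> H))"
      unfolding symmetric_def with_proj_simps
      by (rule symI) (auto simp: cartesian_product_def dest: sG sH)
  qed
qed

lemma pair_graph_torus_graph:
  assumes "m \<ge> 3" "n \<ge> 3"
  shows "pair_graph (torus_graph m n)"
  using assms by (simp add: torus_graph_def pair_graph_cartesian_product pair_graph_cycle_graph)

context pre_digraph
begin

definition shortest_apath :: "'a \<Rightarrow> 'b awalk \<Rightarrow> 'a \<Rightarrow> bool" where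
  "shortest_apath u p v \<longleftrightarrow> apath u p v \<and> (\<forall>q. apath u q v \<longrightarrow> length p \<le> length q)"

definition mutually_visible :: "'a set \<Rightarrow> 'a \<Rightarrow> 'a \<Rightarrow> bool" where
  "mutually_visible P u v \<longleftrightarrow>
     (\<exists>p. shortest_apath u p v \<and> set (awalk_verts u p) \<inter> P \<subseteq> {u, v})"

definition mutual_visibility_set :: "'a set \<Rightarrow> bool" where
  "mutual_visibility_set P \<longleftrightarrow> P \<subseteq> verts G \<and> pairwise (mutually_visible P) P"

text \<open>The maximum exists for finite graphs, see the next lemma.\<close>

definition mutual_visibility_number :: nat where
  "mutual_visibility_number = Max {card P | P. mutual_visibility_set P}"

lemma mutual_visibility_cards:
  assumes "finite (verts G)"
  shows "finite {card P | P. mutual_visibility_set P}"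
    and "{card P | P. mutual_visibility_set P} \<noteq> {}"
proof -
  have "{card P | P. mutual_visibility_set P} \<subseteq> card ` Pow (verts G)"
    by (auto simp: mutual_visibility_set_def)
  then show "finite {card P | P. mutual_visibility_set P}"
    using assms by (blast intro: finite_subset)
  have "mutual_visibility_set {}"
    by (simp add: mutual_visibility_set_def)
  then show "{card P | P. mutual_visibility_set P} \<noteq> {}"
    by blast
qed

end

end

theory Submission
  imports Defs
begin

text \<open>
  Projecting a walk of the torus onto a layer deletes its arcs that run across the layers, so a
  shortest path between two vertices of a layer stays in that layer. Of four members of \<open>P\<close> on one
  layer, listed in cyclic order, the first and the third are separated in the layer by the other two,
  so they are not mutually visible. Hence \<open>P\<close> has at most three vertices on each of the \<open>m\<close> layers
  in one direction, and on each of the \<open>n\<close> layers in the other.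
\<close>

lemma four_in_order:
  fixes A :: "'a :: linorder set"
  assumes "card A \<ge> 4"
  obtains a b c d where "{a, b, c, d} \<subseteq> A" "a < b" "b < c" "c < d"
proof -
  define xs where "xs = sorted_list_of_set A"
  \<comment> \<open>The value of \<open>card\<close> on an infinite set is 0.\<close>
  have "finite A"
    using assms card.infinite by fastforce
  then have xs: "set xs = A" "sorted_wrt (<) xs" "length xs = card A"
    by (auto simp: xs_def)
  have lt: "xs ! i < xs ! j" if "i < j" "j < 4" for i j
    using sorted_wrt_nth_less[OF xs(2)] that xs(3) assms by simp
  have "xs ! i \<in> A" if "i < 4" for i
    using nth_mem[of i xs] that xs assms by simp
  then show ?thesis
    using that[of "xs ! 0" "xs ! 1" "xs ! 2" "xs ! 3"] lt by simp
qed

text \<open>The bounds \<open>b < i\<close> and \<open>i < d < k\<close> keep both neighbours of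
  \<open>i\<close> clear of the wrap-around, so they are \<open>i - 1\<close> and
  \<open>i + 1\<close>.\<close>

lemma cycle_graph_exit:
  assumes "(i, j) \<in> parcs (cycle_graph k)" "d < k"
    and "i \<in> {b<..<d}" "j \<notin> {b<..<d}"
  shows "j \<in> {b, d}"
  using assms by (auto simp: cycle_graph_def mod_Suc split: if_splits)

context wf_digraph
begin

lemma length_awalk_to_apath:
  assumes "awalk u p v"
  shows "length (awalk_to_apath p) \<le> length p"
proof -
  have "distinct (awalk_to_apath p)"
    using apath_awalk_to_apath[OF assms] by (auto simp: apath_def distinct_verts_imp_distinct)
  then have "length (awalk_to_apath p) = card (set (awalk_to_apath p))"
    by (simp add: distinct_card)
  also have "\<dots> \<le> card (set p)"
    using awalk_to_apath_subset[OF assms] by (simp add: card_mono)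
  also have "\<dots> \<le> length p"
    by (rule card_length)
  finally show ?thesis .
qed

text \<open>The definition compares with paths only, whereas projecting a path may give a walk that
  repeats vertices.\<close>

lemma shortest_apath_le_awalk:
  assumes "shortest_apath u p v" "awalk u q v"
  shows "length p \<le> length q"
  using assms apath_awalk_to_apath[OF assms(2)] length_awalk_to_apath[OF assms(2)]
  unfolding shortest_apath_def by (meson order_trans)

lemma awalk_exit:
  assumes "awalk u p v" "u \<in> S" "v \<notin> S"
  obtains x y where "x \<rightarrow> y" "x \<in> S" "y \<notin> S"
    "x \<in> set (awalk_verts u p)" "y \<in> set (awalk_verts u p)"
  using assms
proof (induction p arbitrary: u thesis)
  case Nil
  then show ?case by (simp add: awalk_Nil_iff)
next
  case (Cons e p)
  then have e: "e \<in> arcs G" "u = tail G e" and p: "awalk (head G e) p v"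
    by (simp_all add: awalk_Cons_iff)
  show ?case
  proof (cases "head G e \<in> S")
    case True
    then obtain x y where "x \<rightarrow> y" "x \<in> S" "y \<notin> S"
      "x \<in> set (awalk_verts (head G e) p)" "y \<in> set (awalk_verts (head G e) p)"
      using Cons.IH[OF _ p] Cons.prems by blast
    then show ?thesis
      using Cons.prems(1)[of x y] by simp
  next
    case False
    have "head G e \<in> set (awalk_verts (head G e) p)"
      by (cases p) (use p in \<open>auto simp: awalk_Cons_iff\<close>)
    then show ?thesis
      using Cons.prems(1)[of u "head G e"] Cons.prems(3) e False in_arcs_imp_in_arcs_ends by auto
  qed
qed

text \<open>Map the walk arc by arc under \<open>f\<close> and drop the arcs that collapse. If the
  walk starts at a fixed vertex and meets one that is not fixed, some arc leaves the fixed vertices;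
  by \<open>leave\<close> it collapses, which makes the image strictly shorter.\<close>

lemma awalk_retract:
  assumes verts: "\<And>x. x \<in> verts G \<Longrightarrow> f x \<in> verts G"
    and arcs: "\<And>x y. x \<rightarrow> y \<Longrightarrow> f x = f y \<or> f x \<rightarrow> f y"
    and leave: "\<And>x y. x \<rightarrow> y \<Longrightarrow> f x = x \<Longrightarrow> f y \<noteq> y \<Longrightarrow> f y = x"
    and "awalk u p v"
  shows "\<exists>q. awalk (f u) q (f v) \<and> length q \<le> length p \<and>
    (f u = u \<longrightarrow> (\<exists>x\<in>set (awalk_verts u p). f x \<noteq> x) \<longrightarrow> length q < length p)"
  using assms(4)
proof (induction p arbitrary: u)
  case Nil
  then show ?case
    using verts by (intro exI[of _ "[]"]) (auto simp: awalk_Nil_iff)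
next
  case (Cons e p)
  then have e: "e \<in> arcs G" "u = tail G e" and p: "awalk (head G e) p v"
    by (simp_all add: awalk_Cons_iff)
  then have uh: "u \<rightarrow> head G e"
    using in_arcs_imp_in_arcs_ends by blast
  obtain q where q: "awalk (f (head G e)) q (f v)" "length q \<le> length p"
    "f (head G e) = head G e \<Longrightarrow> \<exists>x\<in>set (awalk_verts (head G e) p). f x \<noteq> x \<Longrightarrow>
      length q < length p"
    using Cons.IH[OF p] by blast
  show ?case
  proof (cases "f u = f (head G e)")
    case True
    then show ?thesis
      using q by (intro exI[of _ q]) auto
  next
    case False
    then obtain a where a: "a \<in> arcs G" "tail G a = f u" "head G a = f (head G e)"
      using arcs[OF uh] by auto
    \<comment> \<open>An arc that does not collapse cannot leave the fixed vertices, so the strict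
      bound for the rest of the walk is available.\<close>
    have "f (head G e) = head G e" if "f u = u"
      using leave[OF uh that] False that by auto
    then show ?thesis
      using q a e by (intro exI[of _ "a # q"]) (auto simp: awalk_Cons_iff)
  qed
qed

text \<open>Otherwise the image of the path under \<open>f\<close> would be a strictly shorter walk
  with the same ends.\<close>

lemma shortest_apath_retract:
  assumes "\<And>x. x \<in> verts G \<Longrightarrow> f x \<in> verts G"
    and "\<And>x y. x \<rightarrow> y \<Longrightarrow> f x = f y \<or> f x \<rightarrow> f y"
    and "\<And>x y. x \<rightarrow> y \<Longrightarrow> f x = x \<Longrightarrow> f y \<noteq> y \<Longrightarrow> f y = x"
    and p: "shortest_apath u p v" and uv: "f u = u" "f v = v"
    and x: "x \<in> set (awalk_verts u p)"
  shows "f x = x"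
proof (rule ccontr)
  assume "f x \<noteq> x"
  have "awalk u p v"
    using p by (simp add: shortest_apath_def apath_def)
  then obtain q where "awalk u q v" "length q < length p"
    using awalk_retract[of f, OF assms(1-3)] uv x \<open>f x \<noteq> x\<close> by metis
  then show False
    using shortest_apath_le_awalk[OF p] by fastforce
qed

text \<open>Here \<open>f\<close> is the projection onto a layer, whose vertices are those it fixes,
  and \<open>g\<close> numbers the layer along a cycle. The abstract form serves both directions of
  the torus.\<close>

lemma card_cycle_layer_le_3:
  assumes "\<And>x. x \<in> verts G \<Longrightarrow> f x \<in> verts G"
    and "\<And>x y. x \<rightarrow> y \<Longrightarrow> f x = f y \<or> f x \<rightarrow> f y"
    and "\<And>x y. x \<rightarrow> y \<Longrightarrow> f x = x \<Longrightarrow> f y \<noteq> y \<Longrightarrow> f y = x"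
    and inj: "inj_on g {..<k}"
    and fixed: "\<And>x. x \<in> verts G \<Longrightarrow> f x = x \<longleftrightarrow> x \<in> g ` {..<k}"
    and cyc: "\<And>i j. i < k \<Longrightarrow> j < k \<Longrightarrow> g i \<rightarrow> g j \<Longrightarrow> (i, j) \<in> parcs (cycle_graph k)"
    and P: "mutual_visibility_set P"
  shows "card {i. i < k \<and> g i \<in> P} \<le> 3"
proof (rule ccontr)
  assume "\<not> ?thesis"
  then have "card {i. i < k \<and> g i \<in> P} \<ge> 4"
    by simp
  then obtain a b c d where abcd: "{a, b, c, d} \<subseteq> {i. i < k \<and> g i \<in> P}" "a < b" "b < c" "c < d"
    by (rule four_in_order)
  have g_eq: "g i = g j \<longleftrightarrow> i = j" if "i < k" "j < k" for i j
    using inj that by (auto simp: inj_on_def)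
  have fixP: "f (g i) = g i" if "g i \<in> P" "i < k" for i
    using fixed[of "g i"] P that by (auto simp: mutual_visibility_set_def)
  \<comment> \<open>The path is taken from \<open>c\<close>, because the arc between
    \<open>b\<close> and \<open>d\<close> around \<open>c\<close> is an interval of indices, while
    the one around \<open>a\<close> wraps past 0.\<close>
  have "mutually_visible P (g c) (g a)"
    using P abcd g_eq[of c a] by (auto simp: mutual_visibility_set_def pairwise_def)
  then obtain p where p: "shortest_apath (g c) p (g a)"
    and vis: "set (awalk_verts (g c) p) \<inter> P \<subseteq> {g c, g a}"
    unfolding mutually_visible_def by blast
  have walk: "awalk (g c) p (g a)"
    using p by (simp add: shortest_apath_def apath_def)
  have layer: "x \<in> g ` {..<k}" if "x \<in> set (awalk_verts (g c) p)" for x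
    using shortest_apath_retract[of f, OF assms(1-3) p _ _ that] fixP abcd fixed
      awalk_verts_in_verts[OF awalk_hd_in_verts[OF walk] _ that] walk by (auto simp: awalk_def)
  have "g c \<in> g ` {b<..<d}" "g a \<notin> g ` {b<..<d}"
    using abcd g_eq by auto
  then obtain x y where xy: "x \<rightarrow> y" "x \<in> g ` {b<..<d}" "y \<notin> g ` {b<..<d}"
    "x \<in> set (awalk_verts (g c) p)" "y \<in> set (awalk_verts (g c) p)"
    using awalk_exit[OF walk] by metis
  obtain i where i: "x = g i" "i \<in> {b<..<d}" "i < k"
    using xy(2) abcd by auto
  obtain j where j: "y = g j" "j < k"
    using layer[OF xy(5)] by auto
  have "(i, j) \<in> parcs (cycle_graph k)"
    using cyc i j xy(1) by blast
  moreover have "j \<notin> {b<..<d}"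
    using j xy(3) by blast
  ultimately have "j \<in> {b, d}"
    using cycle_graph_exit[of i j k d b] i abcd by simp
  \<comment> \<open>The path leaves the interval through \<open>g b\<close> or \<open>g d\<close>.
    Both are in \<open>P\<close>, so visibility would make this vertex an end of the path.\<close>
  then have "y \<in> {g c, g a}"
    using vis xy(5) abcd j by auto
  then show False
    using \<open>j \<in> {b, d}\<close> j g_eq abcd by auto
qed

end

lemma card_layers_le:
  fixes P :: "(nat \<times> nat) set"
  assumes "P \<subseteq> {..<m} \<times> {..<n}" "\<And>u. u < m \<Longrightarrow> card {i. i < n \<and> (u, i) \<in> P} \<le> k"
  shows "card P \<le> k * m"
proof -
  have "P = (SIGMA u:{..<m}. {i. i < n \<and> (u, i) \<in> P})"
    using assms(1) by auto
  then have "card P = card (SIGMA u:{..<m}. {i. i < n \<and> (u, i) \<in> P})"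
    by (rule arg_cong)
  also have "\<dots> = (\<Sum>u<m. card {i. i < n \<and> (u, i) \<in> P})"
    by simp
  also have "\<dots> \<le> (\<Sum>u<m. k)"
    by (rule sum_mono) (simp add: assms(2))
  finally show ?thesis by (simp add: mult.commute)
qed

lemma card_mutual_visibility_set_torus:
  assumes "m \<ge> 3" "n \<ge> 3"
    and P: "pre_digraph.mutual_visibility_set (with_proj (torus_graph m n)) P"
  shows "card P \<le> 3 * min m n"
proof -
  have pg: "pair_graph (torus_graph m n)"
    using assms pair_graph_torus_graph by simp
  interpret wf_digraph "with_proj (torus_graph m n)"
    unfolding wf_digraph_wp_iff using pg by (simp add: pair_graph_def pair_digraph_def pair_fin_digraph_def)
  have verts: "pverts (torus_graph m n) = {..<m} \<times> {..<n}"
    by (simp add: torus_graph_def cartesian_product_def cycle_graph_def)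
  have arcs: "(x, y) \<in> parcs (torus_graph m n) \<longleftrightarrow>
      fst x = fst y \<and> fst x < m \<and> (snd x, snd y) \<in> parcs (cycle_graph n) \<or>
      snd x = snd y \<and> snd x < n \<and> (fst x, fst y) \<in> parcs (cycle_graph m)" for x y
    by (cases x; cases y)
      (auto simp: torus_graph_def cartesian_product_def cycle_graph_def)
  \<comment> \<open>This ensures that an arc between two vertices of a layer comes from the cycle
    along the layer, not from a loop in the other factor.\<close>
  have no_loop: "(i, i) \<notin> parcs (cycle_graph k)" if "k \<ge> 3" for i k
    using that by (auto simp: cycle_graph_def mod_Suc split: if_splits)
  have sub: "P \<subseteq> {..<m} \<times> {..<n}"
    using P verts by (simp add: mutual_visibility_set_def)
  have "card {i. i < n \<and> (u, i) \<in> P} \<le> 3" if "u < m" for u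
    by (rule card_cycle_layer_le_3[where f = "\<lambda>x. (u, snd x)" and g = "\<lambda>i. (u, i)", OF _ _ _ _ _ _ P])
      (use that assms no_loop in \<open>auto simp: verts arcs inj_on_def\<close>)
  then have 1: "card P \<le> 3 * m"
    using card_layers_le[OF sub] by simp
  have "card {i. i < m \<and> (i, w) \<in> P} \<le> 3" if "w < n" for w
    by (rule card_cycle_layer_le_3[where f = "\<lambda>x. (fst x, w)" and g = "\<lambda>i. (i, w)", OF _ _ _ _ _ _ P])
      (use that assms no_loop in \<open>auto simp: verts arcs inj_on_def\<close>)
  \<comment> \<open>The converse relation swaps the coordinates, so the same count applies to the
    layers of the other direction.\<close>
  then have "card (P\<inverse>) \<le> 3 * n"
    using card_layers_le[of "P\<inverse>" n m 3] sub by auto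
  with 1 show ?thesis
    by (simp add: min_def)
qed

theorem corollary4p7:
  fixes m n :: nat
  assumes "m \<ge> 3" and "n \<ge> 3"
  shows "pre_digraph.mutual_visibility_number (with_proj (torus_graph m n)) \<le> 3 * min m n"
proof -
  have "finite (verts (with_proj (torus_graph m n)))"
    by (simp add: torus_graph_def cartesian_product_def cycle_graph_def)
  then show ?thesis
    using pre_digraph.mutual_visibility_cards card_mutual_visibility_set_torus[OF assms]
    unfolding pre_digraph.mutual_visibility_number_def by (subst Max_le_iff) blast+
qed

end
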